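(* Let $m\ge 2$ be an integer with $m\equiv 0\pmod 5$ and let $f:\mathbb{Z}_5\to\mathbb{Z}_5$, $f(x)=x^m$. 1. If $m\equiv 0\pmod{10}$, then the minimal decomposition of $\mathbb{Z}_5$ for $f$ is $$\mathbb{Z}_5=\{0,1\}\ \bigsqcup\ \big((5\mathbb{Z}_5\setminus\{0\})\cup((1+5\mathbb{Z}_5)\setminus\{1\})\cup(2+5\mathbb{Z}_5)\cup(3+5\mathbb{Z}_5)\cup(4+5\mathbb{Z}_5)\big).$$ Here $\{0,1\}$ is the set of periodic points (all of them fixed points), there are no minimal components, and the sets $5\mathbb{Z}_5\setminus\{0\}$ and $((1+5\mathbb{Z}_5)\setminus\{1\})\cup(2+5\mathbb{Z}_5)\cup(3+5\mathbb{Z}_5)\cup(4+5\mathbb{Z}_5)$ are the attracting basins of the fixed points $0$ and $1$, respectively. 2. If $m\equiv 5\pmod{20}$, then the minimal decomposition of $\mathbb{Z}_5$ for $f$ is $$\mathbb{Z}_5=\{0,\pm1,\pm\mathfrak{i}\}\ \bigsqcup\ \big((5\mathbb{Z}_5\setminus\{0\})\cup((1+5\mathbb{Z}_5)\setminus\{1\})\cup((2+5\mathbb{Z}_5)\setminus\{\mathfrak{i}\})\cup((3+5\mathbb{Z}_5)\setminus\{-\mathfrak{i}\})\cup((4+5\mathbb{Z}_5)\setminus\{-1\})\big).$$ Here $\{0,\pm1,\pm\mathfrak{i}\}$ is the set of periodic points (all of them fixed points), there are no minimal components, and the sets $5\mathbb{Z}_5\setminus\{0\}$, $(1+5\mathbb{Z}_5)\setminus\{1\}$,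 $(2+5\mathbb{Z}_5)\setminus\{\mathfrak{i}\}$, $(3+5\mathbb{Z}_5)\setminus\{-\mathfrak{i}\}$ and $(4+5\mathbb{Z}_5)\setminus\{-1\}$ are the attracting basins of the fixed points $0,1,\mathfrak{i},-\mathfrak{i}$ and $-1$, respectively. 3. If $m\equiv 15\pmod{20}$, then the minimal decomposition of $\mathbb{Z}_5$ for $f$ is $$\mathbb{Z}_5=\{0,\pm1,\pm\mathfrak{i}\}\ \bigsqcup\ \big((5\mathbb{Z}_5\setminus\{0\})\cup((1+5\mathbb{Z}_5)\setminus\{1\})\cup((2+5\mathbb{Z}_5)\setminus\{\mathfrak{i}\})\cup((3+5\mathbb{Z}_5)\setminus\{-\mathfrak{i}\})\cup((4+5\mathbb{Z}_5)\setminus\{-1\})\big).$$ Here $\{0,\pm1,\pm\mathfrak{i}\}$ is the set of periodic points, where $0,\pm1$ are fixed points and $\{\mathfrak{i},-\mathfrak{i}\}$ is a periodic orbit of period $2$; there are no minimal components; and the sets $5\mathbb{Z}_5\setminus\{0\}$, $(1+5\mathbb{Z}_5)\setminus\{1\}$, $(4+5\mathbb{Z}_5)\setminus\{-1\}$ and $((2+5\mathbb{Z}_5)\setminus\{\mathfrak{i}\})\cup((3+5\mathbb{Z}_5)\setminus\{-\mathfrak{i}\})$ are the attracting basins of $0$, $1$, $-1$ and $\{\pm\mathfrak{i}\}$, respectively.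
   Context: $\mathbb{Z}_5$ is the ring of $5$-adic integers with its $5$-adic metric. The polynomial $x^5-x$ factors over $\mathbb{Z}_5$ as $x(x-1)(x+1)(x-\mathfrak{i})(x+\mathfrak{i})$, where $\mathfrak{i}=2+5+2\cdot5^2+\cdots\in\mathbb{Z}_5$ is the square root of $-1$ with $\mathfrak{i}\equiv 2\pmod 5$ (so $-\mathfrak{i}\equiv3\pmod 5$). For a polynomial $f$ over $\mathbb{Z}_p$, a minimal decomposition of $\mathbb{Z}_p$ for $f$ is a partition $\mathbb{Z}_p=\mathcal{P}\sqcup\mathcal{M}\sqcup\mathcal{B}$ where (1) $\mathcal{P}$ is the set of all periodic points of $f$; (2) $\mathcal{M}=\bigsqcup_i\mathcal{M}_i$ is a disjoint union of at most countably many clopen $f$-invariant sets, each a finite union of balls, such that each subsystem $f:\mathcal{M}_i\to\mathcal{M}_i$ is minimal (every forward orbit in $\mathcal{M}_i$ is dense in $\mathcal{M}_i$); the $\mathcal{M}_i$ are called minimal components; (3) each point of $\mathcal{B}$ lies in the attracting basin of a periodic orbit or of a minimal component. A point $x$ lies in the attracting basin of a closed invariant set $A$ if the distance from $f^n(x)$ to $A$ tends to $0$ as $n\to\infty$; in describing $\mathcal{B}$, the attracting set itself is not listed as part of its basin. *)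

theory Defs
  imports "HOL-Analysis.Analysis" "HOL-Number_Theory.Cong"
begin

section \<open>The ring of 5-adic integers\<close>

text \<open>
  The 5-adic integers as the inverse limit of the rings \<open>\<int>/5\<^sup>n\<int>\<close>: an element is a
  compatible sequence of residues, the \<open>n\<close>-th one normalised to \<open>{0..<5^n}\<close>.
\<close>

typedef z5 = "{r :: nat \<Rightarrow> int. \<forall>n. r n \<in> {0..<5 ^ n} \<and> r (Suc n) mod 5 ^ n = r n}"
  morphisms residue Abs_z5
  by (rule exI[of _ "\<lambda>_. 0"]) auto

setup_lifting type_definition_z5

lemma residue_mod [simp]: "residue x n mod 5 ^ n = residue x n"
  using residue[of x] by auto

lemma residue_Suc_mod: "residue x (Suc n) mod 5 ^ n = residue x n"
  using residue[of x] by auto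

lemma residue_le_mod: "m \<le> n \<Longrightarrow> residue x n mod 5 ^ m = residue x m"
proof (induction n rule: dec_induct)
  case base
  show ?case by simp
next
  case (step n)
  have "residue x (Suc n) mod 5 ^ m = (residue x (Suc n) mod 5 ^ n) mod 5 ^ m"
    using step.hyps by (simp add: mod_mod_cancel le_imp_power_dvd)
  then show ?case using step.IH by (simp add: residue_Suc_mod)
qed

lemma z5_eqI: "(\<And>n. residue x n = residue y n) \<Longrightarrow> x = y"
  by (metis ext residue_inject)

lemma z5_seq_step:
  assumes "[s (Suc n) = s n] (mod (5::int) ^ n)"
  shows "s n mod 5 ^ n \<in> {0..<5 ^ n} \<and> s (Suc n) mod 5 ^ Suc n mod 5 ^ n = s n mod 5 ^ n"
  using assms by (simp add: mod_mod_cancel cong_def)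

lemma residue_Abs_z5:
  assumes "\<And>n. [s (Suc n) = s n] (mod (5::int) ^ n)"
  shows "residue (Abs_z5 (\<lambda>n. s n mod 5 ^ n)) n = s n mod 5 ^ n"
  using z5_seq_step[of s, OF assms] by (subst Abs_z5_inverse) auto

lemma seq_cong_Suc:
  assumes "\<And>n. r n \<in> {0..<5 ^ n} \<and> r (Suc n) mod 5 ^ n = (r n :: int)"
  shows "[r (Suc n) = r n] (mod 5 ^ n)"
  using assms[of n] by (auto simp: cong_def)

lemma residue_cong_Suc: "[residue x (Suc n) = residue x n] (mod 5 ^ n)"
  by (simp add: cong_def residue_Suc_mod)

instantiation z5 :: comm_ring_1
begin

lift_definition zero_z5 :: z5 is "\<lambda>n. 0" by simp

lift_definition one_z5 :: z5 is "\<lambda>n. 1 mod 5 ^ n"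
  using z5_seq_step[of "\<lambda>_. 1"] by simp

lift_definition plus_z5 :: "z5 \<Rightarrow> z5 \<Rightarrow> z5" is "\<lambda>r s n. (r n + s n) mod 5 ^ n"
  subgoal for r s n
    by (rule z5_seq_step) (intro cong_add seq_cong_Suc; blast)
  done

lift_definition minus_z5 :: "z5 \<Rightarrow> z5 \<Rightarrow> z5" is "\<lambda>r s n. (r n - s n) mod 5 ^ n"
  subgoal for r s n
    by (rule z5_seq_step) (intro cong_diff seq_cong_Suc; blast)
  done

lift_definition uminus_z5 :: "z5 \<Rightarrow> z5" is "\<lambda>r n. (- r n) mod 5 ^ n"
  subgoal for r n
    by (rule z5_seq_step) (simp add: cong_minus_minus_iff seq_cong_Suc)
  done

lift_definition times_z5 :: "z5 \<Rightarrow> z5 \<Rightarrow> z5" is "\<lambda>r s n. (r n * s n) mod 5 ^ n"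
  subgoal for r s n
    by (rule z5_seq_step) (intro cong_mult seq_cong_Suc; blast)
  done

instance
proof
  fix a b c :: z5
  show "a * b * c = a * (b * c)"
    by transfer (auto simp: mod_simps mult.assoc)
  show "a * b = b * a"
    by transfer (simp add: mult.commute)
  show "1 * a = a"
    by transfer (auto simp: mod_simps)
  show "a + b + c = a + (b + c)"
    by transfer (auto simp: mod_simps add.assoc)
  show "a + b = b + a"
    by transfer (simp add: add.commute)
  show "0 + a = a"
    by transfer auto
  show "- a + a = 0"
    by transfer (auto simp: mod_simps)
  show "a - b = a + - b"
    by transfer (auto simp: mod_simps)
  show "(a + b) * c = a * c + b * c"
    by transfer (auto simp: mod_simps algebra_simps)
  show "(0 :: z5) \<noteq> 1"
  proof
    assume "(0 :: z5) = 1"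
    then have "residue 0 1 = residue 1 1" by simp
    then show False by (simp add: zero_z5.rep_eq one_z5.rep_eq)
  qed
qed

end

lemma residue_of_nat: "residue (of_nat k) n = int k mod 5 ^ n"
  by (induction k) (auto simp: zero_z5.rep_eq one_z5.rep_eq plus_z5.rep_eq mod_simps add_ac)

lemma residue_numeral: "residue (numeral k) n = numeral k mod 5 ^ n"
  using residue_of_nat[of "numeral k" n] by simp

lemma residue_power: "residue (x ^ k) n = residue x n ^ k mod 5 ^ n"
  by (induction k) (auto simp: one_z5.rep_eq times_z5.rep_eq mod_simps)

lemma residue_eq_0_iff: "residue x n = 0 \<longleftrightarrow> 5 ^ n dvd x"
proof
  assume "5 ^ n dvd x"
  then obtain y where "x = 5 ^ n * y" by (elim dvdE)
  then show "residue x n = 0"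
    by (simp add: times_z5.rep_eq residue_power residue_numeral mod_simps)
next
  assume 0: "residue x n = 0"
  have dvd: "5 ^ n dvd residue x (n + k)" for k
    using residue_le_mod[of n "n + k" x] 0 by (simp add: dvd_eq_mod_eq_0)
  define s where "s k = residue x (n + k) div 5 ^ n" for k
  have s: "residue x (n + k) = 5 ^ n * s k" for k
    using dvd[of k] by (simp add: s_def)
  have "[5 ^ n * s (Suc k) = 5 ^ n * s k] (mod 5 ^ n * 5 ^ k)" for k
    using residue_cong_Suc[of x "n + k"] s[of "Suc k"] s[of k] by (simp add: power_add)
  then have cong: "[s (Suc k) = s k] (mod 5 ^ k)" for k
    by (simp add: cong_def mod_mult_mult1)
  define y where "y = Abs_z5 (\<lambda>k. s k mod 5 ^ k)"
  have y: "residue y k = s k mod 5 ^ k" for k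
    unfolding y_def by (rule residue_Abs_z5[OF cong])
  have "x = 5 ^ n * y"
  proof (rule z5_eqI)
    fix k
    have "residue x k = residue x (n + k) mod 5 ^ k"
      by (simp add: residue_le_mod)
    then show "residue x k = residue (5 ^ n * y) k"
      by (simp add: times_z5.rep_eq residue_power residue_numeral y s mod_simps)
  qed
  then show "5 ^ n dvd x" by simp
qed

lemma residue_eq_iff: "residue x n = residue y n \<longleftrightarrow> 5 ^ n dvd x - y"
proof -
  have "residue x n = residue y n \<longleftrightarrow> residue (x - y) n = 0"
    by (metis minus_z5.rep_eq mod_eq_0_iff_dvd mod_eq_dvd_iff residue_mod)
  then show ?thesis by (simp add: residue_eq_0_iff)
qed

subsection \<open>The 5-adic metric\<close>

instantiation z5 :: metric_space
begin

text \<open>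
  The exponent is the 5-adic valuation of \<open>x - y\<close>; see \<open>dist_z5_le_iff\<close> and
  \<open>dist_z5_eq_iff\<close> below.
\<close>

definition dist_z5 :: "z5 \<Rightarrow> z5 \<Rightarrow> real" where
  "dist_z5 x y = (if x = y then 0 else (1 / 5) ^ (LEAST n. residue x (Suc n) \<noteq> residue y (Suc n)))"

definition uniformity_z5 :: "(z5 \<times> z5) filter" where
  "uniformity_z5 = (INF e\<in>{0<..}. principal {(x, y). dist x y < e})"

definition open_z5 :: "z5 set \<Rightarrow> bool" where
  "open_z5 U \<longleftrightarrow> (\<forall>x\<in>U. \<forall>\<^sub>F (x', y) in uniformity. x' = x \<longrightarrow> y \<in> U)"

lemma dist_z5_le_aux: "dist x y \<le> (1 / 5) ^ n \<longleftrightarrow> residue x n = residue (y :: z5) n"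
proof (cases "x = y")
  case True
  then show ?thesis by (simp add: dist_z5_def)
next
  case False
  define v where "v = (LEAST n. residue x (Suc n) \<noteq> residue y (Suc n))"
  have 0: "residue x 0 = residue y 0"
    by (metis mod_by_1 power_0 residue_mod)
  obtain k where "residue x k \<noteq> residue y k"
    using False z5_eqI by blast
  with 0 obtain k where "residue x (Suc k) \<noteq> residue y (Suc k)"
    by (cases k) auto
  then have v: "residue x (Suc v) \<noteq> residue y (Suc v)"
    unfolding v_def by (rule LeastI)
  have "residue x n = residue y n" if "n \<le> v"
  proof (cases n)
    case 0
    then show ?thesis using \<open>residue x 0 = residue y 0\<close> by simp
  next
    case (Suc j)
    with that have "j < v" by simp
    then show ?thesis using not_less_Least[of j] Suc unfolding v_def by blast
  qed
  moreover have "residue x n \<noteq> residue y n" if "\<not> n \<le> v"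
    using v that by (metis not_less_eq_eq residue_le_mod)
  moreover have "(1 / 5 :: real) ^ v \<le> (1 / 5) ^ n \<longleftrightarrow> n \<le> v"
    by (rule power_decreasing_iff) auto
  ultimately show ?thesis
    using False by (auto simp: dist_z5_def v_def)
qed

instance
proof
  fix x y z :: z5
  show "uniformity = (INF e\<in>{0<..}. principal {(x :: z5, y). dist x y < e})"
    by (rule uniformity_z5_def)
  show "open U \<longleftrightarrow> (\<forall>x\<in>U. \<forall>\<^sub>F (x', y) in uniformity. x' = x \<longrightarrow> y \<in> U)" for U :: "z5 set"
    by (rule open_z5_def)
  show "dist x y = 0 \<longleftrightarrow> x = y"
    by (simp add: dist_z5_def)
  have nonneg: "0 \<le> dist a b" for a b :: z5
    by (simp add: dist_z5_def)
  have vals: "dist a b = 0 \<or> (\<exists>n. dist a b = (1 / 5) ^ n)" for a b :: z5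
    by (auto simp: dist_z5_def)
  have "dist x y \<le> max (dist x z) (dist y z)"
  proof (cases "max (dist x z) (dist y z) = 0")
    case True
    then have "dist x z = 0" "dist y z = 0"
      using nonneg[of x z] nonneg[of y z] by linarith+
    then have "x = z" "y = z"
      by (auto simp: dist_z5_def split: if_splits)
    then show ?thesis by (simp add: dist_z5_def)
  next
    case False
    then obtain n where n: "max (dist x z) (dist y z) = (1 / 5) ^ n"
      using vals[of x z] vals[of y z] by (metis max_def)
    then have "dist x z \<le> (1 / 5) ^ n" "dist y z \<le> (1 / 5) ^ n"
      by linarith+
    then show ?thesis
      unfolding n dist_z5_le_aux by simp
  qed
  then show "dist x y \<le> dist x z + dist y z"
    using nonneg[of x z] nonneg[of y z] by linarith
qed

end

lemma dist_z5_le_iff: "dist x y \<le> (1 / 5) ^ n \<longleftrightarrow> 5 ^ n dvd x - (y :: z5)"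
  by (simp add: dist_z5_le_aux residue_eq_iff)

lemma dist_z5_eq_iff:
  "dist x y = (1 / 5) ^ n \<longleftrightarrow> 5 ^ n dvd x - y \<and> \<not> 5 ^ Suc n dvd x - (y :: z5)"
proof (cases "x = y")
  case False
  then obtain k where k: "dist x y = (1 / 5) ^ k"
    by (auto simp: dist_z5_def)
  have "(1 / 5 :: real) ^ k \<le> (1 / 5) ^ n \<longleftrightarrow> n \<le> k"
       "(1 / 5 :: real) ^ k \<le> (1 / 5) ^ Suc n \<longleftrightarrow> Suc n \<le> k"
    by (rule power_decreasing_iff; simp)+
  moreover have "(1 / 5 :: real) ^ k = (1 / 5) ^ n \<longleftrightarrow> k = n"
    by (rule power_inject_exp') auto
  ultimately show ?thesis
    unfolding dist_z5_le_iff[symmetric] k by auto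
qed simp

subsection \<open>The square root of -1\<close>

definition z5_i :: z5 where
  "z5_i = (THE x. x\<^sup>2 = - 1 \<and> 5 dvd x - 2)"

lemma ex1_z5_i: "\<exists>!x :: z5. x\<^sup>2 = - 1 \<and> 5 dvd x - 2"
proof -
  have lift: "[a ^ 5 = b ^ 5] (mod 5 ^ Suc n)" if "[a = b] (mod 5 ^ n)" "n > 0" for a b :: int and n
  proof -
    from that obtain c where c: "a = b + 5 ^ n * c"
      by (metis cong_iff_lin cong_sym)
    obtain m where m: "n = Suc m" using \<open>n > 0\<close> by (cases n) auto
    have id: "(b + p * c) ^ 5 - b ^ 5 = (5 * p) * (c * b ^ 4 + 2 * p * c ^ 2 * b ^ 3
        + 2 * p ^ 2 * c ^ 3 * b ^ 2 + p ^ 3 * c ^ 4 * b + q * p ^ 3 * c ^ 5)" if "p = 5 * q" for p q :: int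
      unfolding that by algebra
    have "5 * 5 ^ n dvd a ^ 5 - b ^ 5"
      unfolding c by (subst id[of "5 ^ n" "5 ^ m"]) (simp_all only: m power_Suc dvd_triv_left)
    then show ?thesis by (simp add: cong_iff_dvd_diff)
  qed
  define s :: "nat \<Rightarrow> int" where "s n = 2 ^ 5 ^ n" for n
  have s_Suc: "s (Suc n) = s n ^ 5" for n
    by (simp add: s_def power_mult[symmetric] mult.commute)
  have step: "[s (Suc n) = s n] (mod 5 ^ Suc n)" for n
  proof (induction n)
    case 0
    show ?case by (simp add: s_def cong_def)
  next
    case (Suc n)
    then show ?case using lift[of "s (Suc n)" "s n" "Suc n"] s_Suc by simp
  qed
  have sq: "[s n ^ 2 = - 1] (mod 5 ^ Suc n)" for n
  proof (induction n)
    case 0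
    show ?case by (simp add: s_def cong_def)
  next
    case (Suc n)
    then have "[(s n ^ 2) ^ 5 = (- 1) ^ 5] (mod 5 ^ Suc (Suc n))" by (intro lift) auto
    then show ?case by (simp add: s_Suc power_mult[symmetric] mult.commute)
  qed
  have weaken: "[a = b] (mod 5 ^ n)" if "[a = b] (mod 5 ^ Suc n)" for a b :: int and n
    using that by (rule cong_dvd_modulus) simp
  define i where "i = Abs_z5 (\<lambda>n. s n mod 5 ^ n)"
  have i: "residue i n = s n mod 5 ^ n" for n
    unfolding i_def by (rule residue_Abs_z5[OF weaken[OF step]])
  have "i\<^sup>2 = - 1"
  proof (rule z5_eqI)
    fix n
    show "residue (i\<^sup>2) n = residue (- 1) n"
      using weaken[OF sq[of n]]
      by (simp add: residue_power i uminus_z5.rep_eq one_z5.rep_eq mod_simps cong_def)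
  qed
  moreover have "5 dvd i - 2"
  proof -
    have "residue i 1 = residue 2 1" by (simp add: i s_def residue_numeral)
    then show ?thesis using residue_eq_iff[of i 1 2] by simp
  qed
  moreover have "x = y" if x: "x\<^sup>2 = - 1" "5 dvd x - 2" and y: "y\<^sup>2 = - 1" "5 dvd y - 2" for x y :: z5
  proof (rule z5_eqI)
    fix n
    show "residue x n = residue y n"
    proof (cases "n = 0")
      case True
      then show ?thesis by (simp add: residue_eq_iff)
    next
      case False
      define a b where "a = residue x n" and "b = residue y n"
      have "residue x 1 = 2" "residue y 1 = 2"
        using x y residue_eq_iff[of x 1 2] residue_eq_iff[of y 1 2] by (auto simp: residue_numeral)
      then have "a mod 5 = 2" "b mod 5 = 2"
        using False residue_le_mod[of 1 n x] residue_le_mod[of 1 n y] by (auto simp: a_def b_def)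
      then have "\<not> 5 dvd a + b" by presburger
      then have cop: "coprime (5 ^ n) (a + b)"
        using prime_imp_coprime[of 5 "a + b"] by simp
      have "residue (x\<^sup>2) n = residue (y\<^sup>2) n" using x y by simp
      then have "5 ^ n dvd a\<^sup>2 - b\<^sup>2"
        by (simp add: residue_power a_def b_def mod_eq_dvd_iff)
      then have "5 ^ n dvd (a + b) * (a - b)" by (simp add: power2_eq_square algebra_simps)
      then have "5 ^ n dvd a - b" using cop coprime_dvd_mult_right_iff by blast
      then have "a mod 5 ^ n = b mod 5 ^ n" by (simp add: mod_eq_dvd_iff)
      then show ?thesis by (simp add: a_def b_def)
    qed
  qed
  ultimately show ?thesis by (intro ex1I[of _ i]) auto
qed

lemma z5_i_sq: "z5_i\<^sup>2 = - 1" and z5_i_cong: "5 dvd z5_i - 2"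
  using theI'[OF ex1_z5_i] by (auto simp: z5_i_def)

definition coset5 :: "z5 \<Rightarrow> z5 set" where
  "coset5 a = range (\<lambda>x. a + 5 * x)"


section \<open>Minimal decompositions\<close>

definition periodic_points :: "('a \<Rightarrow> 'a) \<Rightarrow> 'a set" where
  "periodic_points f = {x. \<exists>n>0. (f ^^ n) x = x}"

definition forward_orbit :: "('a \<Rightarrow> 'a) \<Rightarrow> 'a \<Rightarrow> 'a set" where
  "forward_orbit f x = range (\<lambda>n. (f ^^ n) x)"

text \<open>The number \<open>n\<close> is the exact (least) period.\<close>

definition periodic_orbit :: "('a \<Rightarrow> 'a) \<Rightarrow> nat \<Rightarrow> 'a set \<Rightarrow> bool" where
  "periodic_orbit f n A \<longleftrightarrow>
     n > 0 \<and> (\<exists>x. (f ^^ n) x = x \<and> (\<forall>k. 0 < k \<and> k < n \<longrightarrow> (f ^^ k) x \<noteq> x) \<and> A = forward_orbit f x)"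

text \<open>
  Meant for nonempty closed invariant \<open>A\<close>. Such an \<open>A\<close> is contained in its basin, so a
  basin from which the attracting set has been removed is \<open>attracting_basin f A - A\<close>.
\<close>

definition attracting_basin :: "('a::metric_space \<Rightarrow> 'a) \<Rightarrow> 'a set \<Rightarrow> 'a set" where
  "attracting_basin f A = {x. (\<lambda>n. infdist ((f ^^ n) x) A) \<longlonglongrightarrow> 0}"

text \<open>
  Nonemptiness has to be demanded explicitly: the empty set is an empty union of balls, and
  \<open>infdist x {} = 0\<close> would make it attract every point.
\<close>

definition minimal_component :: "('a::metric_space \<Rightarrow> 'a) \<Rightarrow> 'a set \<Rightarrow> bool" where
  "minimal_component f K \<longleftrightarrow>
     K \<noteq> {} \<and> open K \<and> closed K \<and> f ` K \<subseteq> K \<and>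
     (\<exists>\<B>. finite \<B> \<and> (\<forall>b\<in>\<B>. \<exists>x r. r > 0 \<and> b = ball x r) \<and> K = \<Union>\<B>) \<and>
     (\<forall>x\<in>K. K \<subseteq> closure (forward_orbit f x))"

text \<open>
  The second set argument is the family of the minimal components, not their union.
\<close>

definition minimal_decomposition ::
    "('a::metric_space \<Rightarrow> 'a) \<Rightarrow> 'a set \<Rightarrow> 'a set set \<Rightarrow> 'a set \<Rightarrow> bool" where
  "minimal_decomposition f P \<M> B \<longleftrightarrow>
     P \<union> \<Union>\<M> \<union> B = UNIV \<and> P \<inter> \<Union>\<M> = {} \<and> P \<inter> B = {} \<and> \<Union>\<M> \<inter> B = {} \<and>
     P = periodic_points f \<and>
     countable \<M> \<and> disjoint \<M> \<and> (\<forall>K\<in>\<M>. minimal_component f K) \<and>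
     (\<forall>x\<in>B. (\<exists>n A. periodic_orbit f n A \<and> x \<in> attracting_basin f A) \<or>
            (\<exists>K\<in>\<M>. x \<in> attracting_basin f K))"

end

theory Submission
  imports Defs
begin

text \<open>
  Since \<open>5\<close> divides \<open>m\<close>, the map \<open>x \<mapsto> x ^ m\<close> contracts every residue class modulo \<open>5\<close> by a factor
  of \<open>5\<close>: this is lifting the exponent. Each class contains exactly one root of \<open>x ^ 5 - x\<close>, and
  the set of these roots is invariant. Hence every orbit is asymptotic to the orbit of the root in
  its class, and the whole dynamics is read off the action of \<open>m\<close> on the exponents modulo \<open>4\<close>.
\<close>

section \<open>Residue classes modulo 5\<close>

text \<open>The cofactor of \<open>x - y\<close> in \<open>x ^ m - y ^ m\<close> is congruent modulo
  \<open>p\<close> to \<open>m * y ^ (m - 1)\<close>, because \<open>x\<close> and \<open>y\<close>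
  agree modulo \<open>p\<close>. Since \<open>p\<close> divides \<open>m\<close>, the cofactor
  contributes one more factor \<open>p\<close>. The condition \<open>n > 0\<close> is what makes
  \<open>x\<close> and \<open>y\<close> agree modulo \<open>p\<close>.\<close>

lemma power_diff_lift:
  fixes x y p :: "'a :: comm_ring_1"
  assumes "p dvd of_nat m" "p ^ n dvd x - y" "n > 0"
  shows "p ^ Suc n dvd x ^ m - y ^ m"
proof -
  have "p dvd x - y"
    using assms(2,3) by (metis dvd_power dvd_trans)
  have "p dvd (\<Sum>i<m. y ^ (m - Suc i) * x ^ i)"
  proof -
    \<comment> \<open>Replace each \<open>x ^ i\<close> by \<open>y ^ i\<close>; the error is a
      multiple of \<open>x - y\<close>.\<close>
    have "p dvd (\<Sum>i<m. y ^ (m - Suc i) * (x ^ i - y ^ i))"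
    proof (intro dvd_sum dvd_mult)
      fix i
      have "x - y dvd x ^ i - y ^ i"
        by (simp add: power_diff_sumr2)
      with \<open>p dvd x - y\<close> show "p dvd x ^ i - y ^ i"
        by (rule dvd_trans)
    qed
    moreover have "(\<Sum>i<m. y ^ (m - Suc i) * y ^ i) = of_nat m * y ^ (m - 1)"
      by (simp flip: power_add)
    then have "p dvd (\<Sum>i<m. y ^ (m - Suc i) * y ^ i)"
      using assms(1) by simp
    moreover have "(\<Sum>i<m. y ^ (m - Suc i) * x ^ i) =
        (\<Sum>i<m. y ^ (m - Suc i) * (x ^ i - y ^ i)) + (\<Sum>i<m. y ^ (m - Suc i) * y ^ i)"
      by (simp add: right_diff_distrib flip: sum.distrib)
    ultimately show ?thesis
      by (simp only: dvd_add)
  qed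
  with assms(2) have "p ^ n * p dvd (x - y) * (\<Sum>i<m. y ^ (m - Suc i) * x ^ i)"
    by (rule mult_dvd_mono)
  then show ?thesis
    by (simp only: power_diff_sumr2 power_Suc2)
qed

lemma residue_1_eq_iff: "residue x (Suc 0) = residue y (Suc 0) \<longleftrightarrow> 5 dvd x - y"
  using residue_eq_iff[of x "Suc 0" y] by simp

lemma mem_coset5_iff: "x \<in> coset5 a \<longleftrightarrow> 5 dvd x - a"
proof
  assume "5 dvd x - a"
  then obtain k where "x - a = 5 * k" by (elim dvdE)
  then have "x = a + 5 * k" by (simp add: algebra_simps)
  then show "x \<in> coset5 a" unfolding coset5_def by (rule range_eqI)
qed (auto simp: coset5_def)

lemma mem_coset5_iff_residue: "x \<in> coset5 a \<longleftrightarrow> residue x (Suc 0) = residue a (Suc 0)"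
  by (simp add: mem_coset5_iff residue_1_eq_iff)

text \<open>The value 1 is \<open>(1 / 5) ^ 0\<close>, attained exactly by points in different
  classes modulo 5, so distinct classes are separated by a gap of size 1.\<close>

lemma dist_z5_less_1D:
  assumes "dist x y < 1"
  shows "5 dvd x - (y :: z5)"
  using assms dist_z5_eq_iff[of x y 0] by auto

lemma five_power_neq_0: "(5 :: z5) ^ n \<noteq> 0"
proof
  assume "(5 :: z5) ^ n = 0"
  then have "residue (of_nat (5 ^ n)) (Suc n) = residue 0 (Suc n)" by simp
  then show False
    unfolding residue_of_nat by (simp add: zero_z5.rep_eq)
qed

section \<open>Teichmueller representatives\<close>

text \<open>These are the roots of \<open>x ^ 5 - x\<close>, one in each residue class modulo
  5.\<close>

definition teich :: "z5 set" where
  "teich = {0, 1, - 1, z5_i, - z5_i}"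

lemma finite_teich: "finite teich"
  by (simp add: teich_def)

lemma residue_z5_i: "residue z5_i (Suc 0) = 2"
  using z5_i_cong residue_1_eq_iff[of z5_i 2] by (simp add: residue_numeral)

lemmas residue_1_simps =
  zero_z5.rep_eq one_z5.rep_eq uminus_z5.rep_eq residue_numeral residue_z5_i

text \<open>The residues of 0, 1, -1, \<open>z5_i\<close>, \<open>- z5_i\<close> modulo 5 are 0, 1,
  4, 2, 3, hence pairwise different. Together with \<open>ex_teich\<close> this makes
  \<open>teich\<close> a system of representatives.\<close>

lemma teich_cong_imp_eq:
  assumes "s \<in> teich" "t \<in> teich" "5 dvd s - t"
  shows "s = t"
  using assms unfolding residue_1_eq_iff[symmetric]
  by (auto simp: teich_def residue_1_simps)

lemma teich_distinct: "distinct [0, 1, - 1, z5_i, - z5_i]"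
proof -
  have "distinct (map (\<lambda>x. residue x (Suc 0)) [0, 1, - 1, z5_i, - z5_i])"
    by (simp add: residue_1_simps)
  then show ?thesis
    unfolding distinct_map by (rule conjunct1)
qed

lemma ex_teich: "\<exists>t\<in>teich. 5 dvd x - t"
proof -
  have "residue x (Suc 0) \<in> {0..<5}"
    using residue[of x] by (auto dest: spec[of _ "Suc 0"])
  then consider "residue x (Suc 0) = 0" | "residue x (Suc 0) = 1" | "residue x (Suc 0) = 2"
    | "residue x (Suc 0) = 3" | "residue x (Suc 0) = 4"
    by fastforce
  then show ?thesis
    unfolding residue_1_eq_iff[symmetric] by cases (auto simp: teich_def residue_1_simps)
qed

lemma coset5_teich:
  "coset5 z5_i = coset5 2" "coset5 (- z5_i) = coset5 3" "coset5 (- 1) = coset5 4"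
  by (auto simp: mem_coset5_iff_residue residue_1_simps)

lemma UN_coset5: "coset5 0 \<union> coset5 1 \<union> coset5 2 \<union> coset5 3 \<union> coset5 4 = UNIV"
proof -
  have "x \<in> (\<Union>t\<in>teich. coset5 t)" for x
    using ex_teich by (auto simp: mem_coset5_iff)
  then show ?thesis
    by (auto simp: teich_def coset5_teich)
qed

lemma power_mod_4:
  fixes t :: "'a :: monoid_mult"
  assumes "t ^ 4 = 1"
  shows "t ^ n = t ^ (n mod 4)"
proof -
  have "t ^ n = t ^ (4 * (n div 4) + n mod 4)" by simp
  then show ?thesis
    unfolding power_add power_mult assms by simp
qed

lemma z5_i_power: "z5_i ^ 2 = - 1" "z5_i ^ 3 = - z5_i" "z5_i ^ 4 = 1"
proof -
  have "z5_i * z5_i = - 1"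
    using z5_i_sq by (simp add: power2_eq_square)
  then show "z5_i ^ 2 = - 1" "z5_i ^ 3 = - z5_i" "z5_i ^ 4 = 1"
    by (simp_all add: eval_nat_numeral flip: mult.assoc)
qed

lemma teich_power4:
  assumes "t \<in> teich" "t \<noteq> 0"
  shows "t ^ 4 = 1"
  using assms by (auto simp: teich_def z5_i_power)

lemma teich_power:
  assumes "t \<in> teich"
  shows "t ^ n \<in> teich"
proof (cases "t = 0")
  case True
  then show ?thesis by (simp add: teich_def power_0_left)
next
  case False
  have "n mod 4 \<in> {0, 1, 2, 3}" by auto
  then have "t ^ (n mod 4) \<in> teich"
    using assms False by (auto simp: teich_def z5_i_power)
  then show ?thesis
    using power_mod_4[OF teich_power4[OF assms False], of n] by simp
qed


section \<open>Iteration\<close>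

lemma funpow_mem:
  assumes "f ` S \<subseteq> S" "x \<in> S"
  shows "(f ^^ n) x \<in> S"
  using assms by (induction n) auto

lemma periodic_orbit_fixpoint:
  assumes "f a = a"
  shows "periodic_orbit f 1 {a}"
proof -
  have "(f ^^ n) a = a" for n
    using assms by (induction n) auto
  then have "{a} = forward_orbit f a"
    by (auto simp: forward_orbit_def)
  then show ?thesis
    using assms by (auto simp: periodic_orbit_def)
qed

section \<open>Contraction by the power map and its periodic points\<close>

text \<open>The condition \<open>m_pos\<close> rules out the exponent 0, which satisfies
  \<open>m_dvd\<close> but sends 0 to 1.\<close>

locale z5_power =
  fixes m :: nat and f :: "z5 \<Rightarrow> z5"
  assumes m_dvd: "5 dvd m" and m_pos: "m > 0" and f_def: "f = (\<lambda>x. x ^ m)"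
begin

text \<open>Each application of \<open>f\<close> gains one factor 5 by
  \<open>power_diff_lift\<close>; the initial congruence modulo 5 accounts for the
  \<open>Suc\<close>.\<close>

lemma funpow_cong:
  assumes "5 dvd x - y"
  shows "5 ^ Suc n dvd (f ^^ n) x - (f ^^ n) y"
proof (induction n)
  case 0
  show ?case using assms by simp
next
  case (Suc n)
  have "5 dvd (of_nat m :: z5)"
    using m_dvd by (auto elim!: dvdE)
  then show ?case
    unfolding funpow.simps comp_apply using power_diff_lift[OF _ Suc.IH] by (simp only: f_def)
qed

lemma funpow_cong_5:
  assumes "5 dvd x - y"
  shows "5 dvd (f ^^ n) x - (f ^^ n) y"
  using funpow_cong[OF assms, of n] by (metis dvd_mult_left power_Suc)

lemma dist_funpow_le:
  assumes "5 dvd x - y"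
  shows "dist ((f ^^ n) x) ((f ^^ n) y) \<le> (1 / 5) ^ Suc n"
  unfolding dist_z5_le_iff by (rule funpow_cong[OF assms])

lemma f_teich: "f ` teich \<subseteq> teich"
  by (auto simp: f_def teich_power)

text \<open>A point of period \<open>n\<close> is back at itself at every time \<open>n * k\<close>.
  The representative \<open>t\<close> of its class is then back at \<open>t\<close> as well, since
  its orbit stays in \<open>teich\<close> and in step modulo 5. Contraction up to time
  \<open>n * k\<close> makes \<open>x - t\<close> divisible by arbitrarily high powers of 5.\<close>

lemma periodic_points_subset: "periodic_points f \<subseteq> teich"
proof
  fix x assume "x \<in> periodic_points f"
  then obtain n where n: "n > 0" "(f ^^ n) x = x"
    by (auto simp: periodic_points_def)
  obtain t where t: "t \<in> teich" "5 dvd x - t"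
    using ex_teich by blast
  have per: "(f ^^ (n * k)) x = x" for k
    using n(2) by (induction k) (auto simp: funpow_add)
  have "residue x k = residue t k" for k
  proof -
    let ?s = "(f ^^ (n * k)) t"
    have "5 dvd x - ?s"
      using funpow_cong_5[OF t(2), of "n * k"] by (simp add: per)
    then have "5 dvd ?s - t"
      using t(2) by (simp flip: residue_1_eq_iff)
    then have s: "?s = t"
      using teich_cong_imp_eq funpow_mem[OF f_teich t(1)] t(1) by blast
    have "5 ^ Suc (n * k) dvd x - t"
      using funpow_cong[OF t(2), of "n * k"] by (simp only: per s)
    \<comment> \<open>As \<open>n\<close> is at least 1, the exponent reached at time
      \<open>n * k\<close> covers the residue at level \<open>k\<close>.\<close>
    moreover have "k \<le> Suc (n * k)"
      using n(1) by (cases n) auto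
    ultimately show ?thesis
      unfolding residue_eq_iff by (meson dvd_trans le_imp_power_dvd)
  qed
  then have "x = t" by (rule z5_eqI)
  with t show "x \<in> teich" by simp
qed

section \<open>Attracting basins\<close>

text \<open>The orbits of \<open>x\<close> and \<open>t\<close> are asymptotic, so only the orbit of
  \<open>t\<close> matters. It lives in \<open>teich\<close>, whose points are at mutual distance 1;
  approaching \<open>A\<close> therefore means landing in \<open>A\<close>, and by invariance
  staying there.\<close>

lemma mem_attracting_basin_iff:
  assumes A: "A \<subseteq> teich" "A \<noteq> {}" "f ` A \<subseteq> A" and t: "t \<in> teich" "5 dvd x - t"
  shows "x \<in> attracting_basin f A \<longleftrightarrow> (\<exists>n. (f ^^ n) t \<in> A)"
proof
  assume "x \<in> attracting_basin f A"
  then have "(\<lambda>n. infdist ((f ^^ n) x) A) \<longlonglongrightarrow> 0"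
    by (simp add: attracting_basin_def)
  then have "\<forall>\<^sub>F n in sequentially. infdist ((f ^^ n) x) A < 1"
    by (rule order_tendstoD) simp
  then obtain n where n: "infdist ((f ^^ n) x) A < 1"
    by (auto simp: eventually_sequentially)
  \<comment> \<open>An infimum over the nonempty \<open>A\<close> below 1 has a witness below 1, and
    distance below 1 means congruence modulo 5.\<close>
  have "\<exists>a\<in>A. dist ((f ^^ n) x) a < 1"
    using n A(2) by (simp add: infdist_def cINF_less_iff)
  then obtain a where a: "a \<in> A" "5 dvd (f ^^ n) x - a"
    using dist_z5_less_1D by blast
  have "5 dvd (f ^^ n) t - a"
    using funpow_cong_5[OF t(2), of n] a(2) by (simp flip: residue_1_eq_iff)
  then have "(f ^^ n) t = a"
    using teich_cong_imp_eq funpow_mem[OF f_teich t(1)] a(1) A(1) by blast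
  with a(1) show "\<exists>n. (f ^^ n) t \<in> A" by blast
next
  assume "\<exists>n. (f ^^ n) t \<in> A"
  then obtain N where N: "(f ^^ N) t \<in> A" by blast
  have mem: "(f ^^ n) t \<in> A" if "n \<ge> N" for n
  proof -
    have "(f ^^ n) t = (f ^^ (n - N)) ((f ^^ N) t)"
      using that by (metis comp_apply funpow_add le_add_diff_inverse2)
    then show ?thesis
      using funpow_mem[OF A(3) N] by simp
  qed
  have "(\<lambda>n. infdist ((f ^^ n) x) A) \<longlonglongrightarrow> 0"
  proof (rule real_tendsto_sandwich)
    show "\<forall>\<^sub>F n in sequentially. 0 \<le> infdist ((f ^^ n) x) A"
      by (simp add: infdist_nonneg)
    show "\<forall>\<^sub>F n in sequentially. infdist ((f ^^ n) x) A \<le> (1 / 5) ^ Suc n"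
      using eventually_ge_at_top[of N]
    proof eventually_elim
      case (elim n)
      show ?case
        using infdist_le[OF mem[OF elim]] dist_funpow_le[OF t(2)] order_trans by blast
    qed
    show "(\<lambda>n. (1 / 5 :: real) ^ Suc n) \<longlonglongrightarrow> 0"
      by (intro LIMSEQ_Suc LIMSEQ_power_zero) simp
  qed simp
  then show "x \<in> attracting_basin f A"
    by (simp add: attracting_basin_def)
qed

text \<open>Here \<open>B\<close> consists of the representatives whose orbits enter
  \<open>A\<close>: the last assumption puts all of \<open>B\<close> there, and invariance of
  \<open>teich - B\<close> keeps the others away from \<open>A\<close>. The basin is then a union of
  full residue classes.\<close>

lemma attracting_basin_eq:
  assumes "A \<subseteq> B" "B \<subseteq> teich" "A \<noteq> {}" "f ` A \<subseteq> A" "f ` (teich - B) \<subseteq> teich - B"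
    and "\<And>t. t \<in> B \<Longrightarrow> \<exists>n. (f ^^ n) t \<in> A"
  shows "attracting_basin f A = (\<Union>t\<in>B. coset5 t)"
proof (rule set_eqI)
  fix x
  obtain t where t: "t \<in> teich" "5 dvd x - t"
    using ex_teich by blast
  have "x \<in> attracting_basin f A \<longleftrightarrow> (\<exists>n. (f ^^ n) t \<in> A)"
    using mem_attracting_basin_iff[of A t x] t assms(1-4) by blast
  also have "\<dots> \<longleftrightarrow> t \<in> B"
    using funpow_mem[OF assms(5)] t(1) assms(1,6) by blast
  also have "\<dots> \<longleftrightarrow> x \<in> (\<Union>t\<in>B. coset5 t)"
  proof
    assume "x \<in> (\<Union>t\<in>B. coset5 t)"
    then obtain s where s: "s \<in> B" "5 dvd x - s"
      by (auto simp: mem_coset5_iff)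
    with t(2) have "5 dvd s - t"
      by (simp flip: residue_1_eq_iff)
    with s(1) t(1) assms(2) show "t \<in> B"
      using teich_cong_imp_eq by blast
  qed (use t in \<open>auto simp: mem_coset5_iff\<close>)
  finally show "x \<in> attracting_basin f A \<longleftrightarrow> x \<in> (\<Union>t\<in>B. coset5 t)" .
qed

lemma attracting_basin_eq_self:
  assumes "A \<subseteq> teich" "A \<noteq> {}" "f ` A \<subseteq> A" "f ` (teich - A) \<subseteq> teich - A"
  shows "attracting_basin f A = (\<Union>t\<in>A. coset5 t)"
proof (rule attracting_basin_eq)
  show "\<exists>n. (f ^^ n) t \<in> A" if "t \<in> A" for t
    using that by (intro exI[of _ 0]) simp
qed (use assms in auto)

section \<open>Absence of minimal components\<close>

text \<open>A closed invariant \<open>K\<close> contains a limit point \<open>s\<close> of one of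
  its orbits, and \<open>s\<close> can be taken in \<open>teich\<close>. The orbit of
  \<open>s\<close> is contained in the finite set \<open>teich\<close>, so density forces
  \<open>K\<close> into \<open>teich\<close>; but \<open>K\<close> is open and \<open>s\<close> is
  not isolated.\<close>

lemma no_minimal_component: "\<not> minimal_component f K"
proof
  assume "minimal_component f K"
  then have K: "K \<noteq> {}" "open K" "closed K" "f ` K \<subseteq> K"
    and dense: "\<And>x. x \<in> K \<Longrightarrow> K \<subseteq> closure (forward_orbit f x)"
    by (auto simp: minimal_component_def)
  obtain x where x: "x \<in> K" using K(1) by blast
  obtain t where t: "t \<in> teich" "5 dvd x - t"
    using ex_teich by blast
  \<comment> \<open>By the pigeonhole principle the orbit of \<open>t\<close> visits some
    \<open>s\<close> infinitely often, and along these times the orbit of \<open>x\<close> converges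
    to \<open>s\<close>.\<close>
  have "finite (range (\<lambda>n. (f ^^ n) t))"
    by (rule finite_subset[OF _ finite_teich]) (use funpow_mem[OF f_teich t(1)] in blast)
  then obtain s where s: "s \<in> range (\<lambda>n. (f ^^ n) t)" "infinite ((\<lambda>n. (f ^^ n) t) -` {s})"
    by (rule inf_img_fin_domE) simp
  have "s \<in> teich"
    using s(1) funpow_mem[OF f_teich t(1)] by blast
  have "\<exists>y\<in>K. dist y s < e" if e: "e > 0" for e
  proof -
    obtain N where N: "(1 / 5) ^ N < e"
      using real_arch_pow_inv[OF e, of "1 / 5"] by fastforce
    obtain n where n: "n \<ge> N" "(f ^^ n) t = s"
      using s(2) unfolding infinite_nat_iff_unbounded_le by auto
    have "dist ((f ^^ n) x) s \<le> (1 / 5) ^ Suc n"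
      using dist_funpow_le[OF t(2), of n] n(2) by simp
    also have "\<dots> \<le> (1 / 5) ^ N"
      using n(1) by (intro power_decreasing) auto
    finally have "dist ((f ^^ n) x) s < e"
      using N by simp
    then show ?thesis
      using funpow_mem[OF K(4) x] by blast
  qed
  then have "s \<in> K"
    using closed_approachable[OF K(3)] by blast
  have "forward_orbit f s \<subseteq> teich"
    using funpow_mem[OF f_teich \<open>s \<in> teich\<close>] by (auto simp: forward_orbit_def)
  then have "closure (forward_orbit f s) \<subseteq> teich"
    by (rule closure_minimal) (simp add: finite_teich finite_imp_closed)
  then have "K \<subseteq> teich"
    using dense[OF \<open>s \<in> K\<close>] by blast
  obtain e where e: "e > 0" "\<And>y. dist y s < e \<Longrightarrow> y \<in> K"
    using K(2) \<open>s \<in> K\<close> unfolding open_dist by blast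
  obtain N where N: "(1 / 5) ^ N < e"
    using real_arch_pow_inv[OF e(1), of "1 / 5"] by fastforce
  \<comment> \<open>The exponent \<open>Suc N\<close> makes \<open>y\<close> close to
    \<open>s\<close> and, even for \<open>N = 0\<close>, congruent to \<open>s\<close> modulo 5.
    Membership in \<open>teich\<close> would then give \<open>y = s\<close>.\<close>
  define y where "y = s + 5 ^ Suc N"
  have "dist y s \<le> (1 / 5) ^ N"
    unfolding dist_z5_le_iff y_def by (simp add: le_imp_power_dvd)
  then have "dist y s < e"
    using N by simp
  then have "y \<in> teich"
    using e(2) \<open>K \<subseteq> teich\<close> by blast
  moreover have "5 dvd y - s"
    by (simp add: y_def)
  ultimately have "y = s"
    using teich_cong_imp_eq \<open>s \<in> teich\<close> by blast
  then show False
    using five_power_neq_0[of "Suc N"] by (simp add: y_def)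
qed

text \<open>Every point lies in the class of some representative, so the attraction condition needs
  checking only for the five classes.\<close>

lemma minimal_decompositionI:
  assumes "periodic_points f = P" "P \<union> B = UNIV" "P \<inter> B = {}"
    and basins: "\<And>t. t \<in> teich \<Longrightarrow> \<exists>n A. periodic_orbit f n A \<and> coset5 t \<subseteq> attracting_basin f A"
  shows "minimal_decomposition f P {} B"
proof -
  have "\<exists>n A. periodic_orbit f n A \<and> x \<in> attracting_basin f A" for x
  proof -
    obtain t where t: "t \<in> teich" "x \<in> coset5 t"
      using ex_teich[of x] unfolding mem_coset5_iff[symmetric] by blast
    then show ?thesis
      using basins[OF t(1)] by blast
  qed
  then show ?thesis
    using assms(1-3) unfolding minimal_decomposition_def by simp
qed

section \<open>Action on the representatives, by the exponent modulo 4\<close>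

lemma f_0: "f 0 = 0" and f_1: "f 1 = 1"
  using m_pos by (simp_all add: f_def zero_power)

text \<open>Nonzero representatives are fourth roots of unity. The point 0 is excluded because
  \<open>m mod 4\<close> may be 0, and \<open>0 ^ 0 = 1\<close>.\<close>

lemma f_unit:
  assumes "t \<in> teich" "t \<noteq> 0"
  shows "f t = t ^ (m mod 4)"
  unfolding f_def by (rule power_mod_4[OF teich_power4[OF assms]])

text \<open>For even \<open>m\<close> the square \<open>m * m\<close> is divisible by 4, so two
  applications of \<open>f\<close> send every nonzero representative to 1, and nothing but 0 and 1
  can recur.\<close>

lemma dynamics_even:
  assumes "even m"
  shows
    "minimal_decomposition f {0, 1} {}
       ((coset5 0 - {0}) \<union> ((coset5 1 - {1}) \<union> coset5 2 \<union> coset5 3 \<union> coset5 4))" (is ?decomp)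
    "periodic_points f = {0, 1}" (is ?periodic)
    "attracting_basin f {0} - {0} = coset5 0 - {0}" (is ?basin0)
    "attracting_basin f {1} - {1} = (coset5 1 - {1}) \<union> coset5 2 \<union> coset5 3 \<union> coset5 4" (is ?basin1)
proof -
  have f_square: "f (f t) = 1" if "t \<in> teich" "t \<noteq> 0" for t
  proof -
    obtain k where "m = 2 * k"
      using assms by (elim evenE)
    then have "m * m = 4 * (k * k)" by simp
    then have "f (f t) = (t ^ 4) ^ (k * k)"
      unfolding f_def by (metis power_mult)
    then show ?thesis
      by (simp add: teich_power4[OF that])
  qed
  have nonzero: "f t \<noteq> 0" if "t \<in> teich" "t \<noteq> 0" for t
    using f_square[OF that] f_0 by auto
  have basin0: "attracting_basin f {0} = (\<Union>t\<in>{0}. coset5 t)"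
  proof (rule attracting_basin_eq_self)
    show "f ` (teich - {0}) \<subseteq> teich - {0}"
      using f_teich nonzero by (auto intro!: image_subsetI)
  qed (simp_all add: teich_def f_0)
  then show ?basin0 by simp
  have basin1_teich: "attracting_basin f {1} = (\<Union>t\<in>teich - {0}. coset5 t)"
  proof (rule attracting_basin_eq)
    show "\<exists>n. (f ^^ n) t \<in> {1}" if "t \<in> teich - {0}" for t
      using f_square[of t] that by (intro exI[of _ 2]) (simp add: numeral_2_eq_2)
  qed (auto simp: teich_def f_0 f_1)
  have "teich - {0} = {1, - 1, z5_i, - z5_i}"
    using teich_distinct by (auto simp: teich_def)
  then have "attracting_basin f {1} = coset5 1 \<union> coset5 2 \<union> coset5 3 \<union> coset5 4"
    unfolding basin1_teich by (auto simp: coset5_teich)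
  then show ?basin1
    by (auto simp: mem_coset5_iff_residue residue_1_simps)
  show periodic: ?periodic
  proof
    show "periodic_points f \<subseteq> {0, 1}"
    proof
      fix t assume t: "t \<in> periodic_points f"
      then obtain n where n: "n > 0" "(f ^^ n) t = t"
        by (auto simp: periodic_points_def)
      \<comment> \<open>Doubling the period makes it at least 2, which leaves room for the two steps
        that carry a nonzero \<open>t\<close> to the fixed point 1.\<close>
      obtain k where k: "n + n = Suc (Suc k)"
        using n(1) by (cases n) auto
      have "(f ^^ (n + n)) t = t"
        using n(2) by (simp add: funpow_add)
      then have "(f ^^ k) (f (f t)) = t"
        unfolding k by (simp add: funpow_Suc_right del: funpow.simps)
      then show "t \<in> {0, 1}"
        using t periodic_points_subset f_square[of t] funpow_mem[of f "{1}" 1 k] f_1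
        by (cases "t = 0") auto
    qed
    show "{0, 1} \<subseteq> periodic_points f"
      using f_0 f_1 by (auto simp: periodic_points_def intro!: exI[of _ 1])
  qed
  show ?decomp
  proof (rule minimal_decompositionI[OF periodic])
    fix t assume "t \<in> teich"
    then have "coset5 t \<subseteq> attracting_basin f {0} \<or> coset5 t \<subseteq> attracting_basin f {1}"
      unfolding basin0 basin1_teich by blast
    then show "\<exists>n A. periodic_orbit f n A \<and> coset5 t \<subseteq> attracting_basin f A"
      using periodic_orbit_fixpoint[of f 0, OF f_0] periodic_orbit_fixpoint[of f 1, OF f_1] by blast
  qed (use UN_coset5 in \<open>auto simp: mem_coset5_iff_residue residue_1_simps\<close>)
qed

lemma minimal_decomposition_odd:
  assumes "periodic_points f = teich"
    and "\<And>t. t \<in> teich \<Longrightarrow> \<exists>n A. periodic_orbit f n A \<and> coset5 t \<subseteq> attracting_basin f A"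
  shows "minimal_decomposition f {0, 1, - 1, z5_i, - z5_i} {}
    ((coset5 0 - {0}) \<union> (coset5 1 - {1}) \<union> (coset5 2 - {z5_i}) \<union>
     (coset5 3 - {- z5_i}) \<union> (coset5 4 - {- 1}))"
proof (rule minimal_decompositionI)
  show "periodic_points f = {0, 1, - 1, z5_i, - z5_i}"
    using assms(1) by (simp add: teich_def)
  show "\<exists>n A. periodic_orbit f n A \<and> coset5 t \<subseteq> attracting_basin f A" if "t \<in> teich" for t
    by (rule assms(2)[OF that])
qed (use UN_coset5 in \<open>auto simp: mem_coset5_iff_residue residue_1_simps\<close>)

text \<open>By \<open>f_unit\<close>, \<open>f\<close> is the identity on \<open>teich\<close>, so
  each class is the basin of its own representative.\<close>

lemma dynamics_1_mod_4:
  assumes "m mod 4 = 1"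
  shows
    "minimal_decomposition f {0, 1, - 1, z5_i, - z5_i} {}
       ((coset5 0 - {0}) \<union> (coset5 1 - {1}) \<union> (coset5 2 - {z5_i}) \<union>
        (coset5 3 - {- z5_i}) \<union> (coset5 4 - {- 1}))" (is ?decomp)
    "periodic_points f = {0, 1, - 1, z5_i, - z5_i}" (is ?periodic)
    "t \<in> {0, 1, - 1, z5_i, - z5_i} \<Longrightarrow> f t = t"
    "t \<in> {0, 1, - 1, z5_i, - z5_i} \<Longrightarrow> attracting_basin f {t} = coset5 t"
proof -
  have fixed: "f t = t" if "t \<in> teich" for t
    using f_unit[OF that] assms f_0 by (cases "t = 0") auto
  have basin: "attracting_basin f {t} = coset5 t" if "t \<in> teich" for t
  proof -
    have "f ` (teich - {t}) \<subseteq> teich - {t}"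
      using fixed by auto
    then show ?thesis
      using attracting_basin_eq_self[of "{t}"] fixed[OF that] that by simp
  qed
  have periodic: "periodic_points f = teich"
  proof
    show "teich \<subseteq> periodic_points f"
      unfolding periodic_points_def using fixed by (auto intro!: exI[of _ 1])
  qed (fact periodic_points_subset)
  then show ?periodic
    by (simp add: teich_def)
  show ?decomp
  proof (rule minimal_decomposition_odd[OF periodic])
    fix t assume t: "t \<in> teich"
    have "periodic_orbit f 1 {t}"
      by (rule periodic_orbit_fixpoint) (rule fixed[OF t])
    then show "\<exists>n A. periodic_orbit f n A \<and> coset5 t \<subseteq> attracting_basin f A"
      using basin[OF t] by blast
  qed
  show "t \<in> {0, 1, - 1, z5_i, - z5_i} \<Longrightarrow> f t = t"
    using fixed by (simp add: teich_def)
  show "t \<in> {0, 1, - 1, z5_i, - z5_i} \<Longrightarrow> attracting_basin f {t} = coset5 t"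
    using basin by (simp add: teich_def)
qed

text \<open>On the fourth roots of unity \<open>f\<close> is \<open>t \<mapsto> t ^ 3\<close>, that
  is, inversion: it fixes 1 and -1 and swaps \<open>z5_i\<close> with \<open>- z5_i\<close>.\<close>

lemma dynamics_3_mod_4:
  assumes "m mod 4 = 3"
  shows
    "minimal_decomposition f {0, 1, - 1, z5_i, - z5_i} {}
       ((coset5 0 - {0}) \<union> (coset5 1 - {1}) \<union> (coset5 2 - {z5_i}) \<union>
        (coset5 3 - {- z5_i}) \<union> (coset5 4 - {- 1}))" (is ?decomp)
    "periodic_points f = {0, 1, - 1, z5_i, - z5_i}" (is ?periodic)
    "t \<in> {0, 1, - 1} \<Longrightarrow> f t = t"
    "t \<in> {0, 1, - 1} \<Longrightarrow> attracting_basin f {t} = coset5 t"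
    "periodic_orbit f 2 {z5_i, - z5_i}" (is ?orbit)
    "attracting_basin f {z5_i, - z5_i} = coset5 2 \<union> coset5 3" (is ?basin)
proof -
  have distinct: "z5_i \<noteq> - z5_i" "z5_i \<notin> {0, 1, - 1}" "- z5_i \<notin> {0, 1, - 1}"
    using teich_distinct by auto
  have fixed: "f t = t" if "t \<in> {0, 1, - 1}" for t
    using that f_unit[of t] assms f_0 by (auto simp: teich_def)
  have swap: "f z5_i = - z5_i" "f (- z5_i) = z5_i"
    using f_unit[of z5_i] f_unit[of "- z5_i"] distinct assms
    by (auto simp: teich_def z5_i_power)
  show "t \<in> {0, 1, - 1} \<Longrightarrow> f t = t"
    by (rule fixed)
  have basin: "attracting_basin f {t} = coset5 t" if "t \<in> {0, 1, - 1}" for t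
  proof -
    have "f ` (teich - {t}) \<subseteq> teich - {t}"
    proof
      fix y assume "y \<in> f ` (teich - {t})"
      then obtain s where s: "s \<in> teich" "s \<noteq> t" "y = f s" by blast
      \<comment> \<open>Either \<open>s\<close> is fixed, so \<open>y = s\<close> differs from
        \<open>t\<close>, or \<open>y\<close> belongs to the swapped pair, which does not contain
        \<open>t\<close>.\<close>
      then have "s \<in> {0, 1, - 1} \<or> y \<in> {z5_i, - z5_i}"
        using swap by (auto simp: teich_def)
      then have "y \<noteq> t"
        using s(2,3) that fixed[of s] distinct by auto
      then show "y \<in> teich - {t}"
        using s f_teich by blast
    qed
    moreover have "t \<in> teich"
      using that by (auto simp: teich_def)
    ultimately show ?thesis
      using attracting_basin_eq_self[of "{t}"] fixed[OF that] by simp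
  qed
  then show "t \<in> {0, 1, - 1} \<Longrightarrow> attracting_basin f {t} = coset5 t" .
  have "attracting_basin f {z5_i, - z5_i} = (\<Union>t\<in>{z5_i, - z5_i}. coset5 t)"
  proof (rule attracting_basin_eq_self)
    show "f ` (teich - {z5_i, - z5_i}) \<subseteq> teich - {z5_i, - z5_i}"
    proof (rule image_subsetI)
      fix s assume "s \<in> teich - {z5_i, - z5_i}"
      moreover from this have "s \<in> {0, 1, - 1}"
        by (auto simp: teich_def)
      ultimately show "f s \<in> teich - {z5_i, - z5_i}"
        using fixed by simp
    qed
  qed (simp_all add: teich_def swap)
  then show basin_i: ?basin
    by (simp add: coset5_teich)
  have "{z5_i, - z5_i} = forward_orbit f z5_i"
  proof
    show "{z5_i, - z5_i} \<subseteq> forward_orbit f z5_i"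
      using rangeI[of "\<lambda>n. (f ^^ n) z5_i" 0] rangeI[of "\<lambda>n. (f ^^ n) z5_i" 1]
      by (simp add: forward_orbit_def swap(1))
    show "forward_orbit f z5_i \<subseteq> {z5_i, - z5_i}"
      using funpow_mem[of f "{z5_i, - z5_i}" z5_i] swap by (auto simp: forward_orbit_def)
  qed
  then show orbit: ?orbit
    unfolding periodic_orbit_def using swap distinct(1)
    by (intro conjI exI[of _ z5_i]) (auto simp: numeral_2_eq_2 less_Suc_eq)
  \<comment> \<open>Fixed points and the swapped pair alike return after two steps, so one exponent
    witnesses periodicity for all of \<open>teich\<close>.\<close>
  have "f (f t) = t" if "t \<in> teich" for t
  proof (cases "t \<in> {0, 1, - 1}")
    case True
    show ?thesis by (simp only: fixed[OF True])
  next
    case False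
    then have "t = z5_i \<or> t = - z5_i"
      using that by (simp add: teich_def)
    then show ?thesis
      by (elim disjE) (simp_all only: swap)
  qed
  then have "teich \<subseteq> periodic_points f"
    unfolding periodic_points_def by (auto simp: numeral_2_eq_2 intro!: exI[of _ 2])
  with periodic_points_subset have periodic: "periodic_points f = teich"
    by (rule equalityI)
  then show ?periodic
    by (simp add: teich_def)
  show ?decomp
  proof (rule minimal_decomposition_odd[OF periodic])
    fix t assume "t \<in> teich"
    then consider "t \<in> {0, 1, - 1}" | "t \<in> {z5_i, - z5_i}"
      by (auto simp: teich_def)
    then show "\<exists>n A. periodic_orbit f n A \<and> coset5 t \<subseteq> attracting_basin f A"
    proof cases
      case 1
      have "periodic_orbit f 1 {t}"
        by (rule periodic_orbit_fixpoint) (rule fixed[OF 1])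
      then show ?thesis
        using basin[OF 1] by blast
    next
      case 2
      then have "coset5 t \<subseteq> attracting_basin f {z5_i, - z5_i}"
        unfolding basin_i by (auto simp: coset5_teich)
      with orbit show ?thesis by blast
    qed
  qed
qed

end

section \<open>Assembly of the three congruence cases\<close>

theorem theorem5p1:
  fixes m :: nat and f :: "z5 \<Rightarrow> z5"
  assumes m_ge: "m \<ge> 2" and m_cong: "[m = 0] (mod 5)"
    and f_def: "f = (\<lambda>x. x ^ m)"
  shows
    "([m = 0] (mod 10) \<longrightarrow>
       minimal_decomposition f {0, 1} {}
         ((coset5 0 - {0}) \<union> ((coset5 1 - {1}) \<union> coset5 2 \<union> coset5 3 \<union> coset5 4)) \<and>
       periodic_points f = {0, 1} \<and>
       f 0 = 0 \<and> f 1 = 1 \<and>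
       (\<nexists>K. minimal_component f K) \<and>
       attracting_basin f {0} - {0} = coset5 0 - {0} \<and>
       attracting_basin f {1} - {1} = (coset5 1 - {1}) \<union> coset5 2 \<union> coset5 3 \<union> coset5 4) \<and>
     ([m = 5] (mod 20) \<longrightarrow>
       minimal_decomposition f {0, 1, - 1, z5_i, - z5_i} {}
         ((coset5 0 - {0}) \<union> (coset5 1 - {1}) \<union> (coset5 2 - {z5_i}) \<union>
          (coset5 3 - {- z5_i}) \<union> (coset5 4 - {- 1})) \<and>
       periodic_points f = {0, 1, - 1, z5_i, - z5_i} \<and>
       f 0 = 0 \<and> f 1 = 1 \<and> f (- 1) = - 1 \<and> f z5_i = z5_i \<and> f (- z5_i) = - z5_i \<and>
       (\<nexists>K. minimal_component f K) \<and>
       attracting_basin f {0} - {0} = coset5 0 - {0} \<and>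
       attracting_basin f {1} - {1} = coset5 1 - {1} \<and>
       attracting_basin f {z5_i} - {z5_i} = coset5 2 - {z5_i} \<and>
       attracting_basin f {- z5_i} - {- z5_i} = coset5 3 - {- z5_i} \<and>
       attracting_basin f {- 1} - {- 1} = coset5 4 - {- 1}) \<and>
     ([m = 15] (mod 20) \<longrightarrow>
       minimal_decomposition f {0, 1, - 1, z5_i, - z5_i} {}
         ((coset5 0 - {0}) \<union> (coset5 1 - {1}) \<union> (coset5 2 - {z5_i}) \<union>
          (coset5 3 - {- z5_i}) \<union> (coset5 4 - {- 1})) \<and>
       periodic_points f = {0, 1, - 1, z5_i, - z5_i} \<and>
       f 0 = 0 \<and> f 1 = 1 \<and> f (- 1) = - 1 \<and>
       periodic_orbit f 2 {z5_i, - z5_i} \<and>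
       (\<nexists>K. minimal_component f K) \<and>
       attracting_basin f {0} - {0} = coset5 0 - {0} \<and>
       attracting_basin f {1} - {1} = coset5 1 - {1} \<and>
       attracting_basin f {- 1} - {- 1} = coset5 4 - {- 1} \<and>
       attracting_basin f {z5_i, - z5_i} - {z5_i, - z5_i} =
         (coset5 2 - {z5_i}) \<union> (coset5 3 - {- z5_i}))"
proof -
  interpret z5_power m f
    using m_ge m_cong f_def by unfold_locales (auto simp: cong_0_iff)
  have m4: "m mod 4 = k mod 4" if "[m = k] (mod 20)" for k
    using cong_dvd_modulus_nat[OF that, of 4] by (simp add: cong_def)
  show ?thesis (is "(?c1 \<longrightarrow> ?e1) \<and> (?c2 \<longrightarrow> ?e2) \<and> (?c3 \<longrightarrow> ?e3)")
  proof (rule conjI[OF impI conjI[OF impI impI]])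
    assume "[m = 0] (mod 10)"
    then have "even m"
      using cong_dvd_modulus_nat[of m 0 10 2] by (simp add: cong_0_iff)
    from dynamics_even[OF this] show ?e1
      using f_0 f_1 no_minimal_component by simp
  next
    assume "[m = 5] (mod 20)"
    with m4 have "m mod 4 = 1" by fastforce
    note dynamics = dynamics_1_mod_4[OF this]
    show ?e2
      using dynamics(1,2) no_minimal_component by (simp add: dynamics(3,4) coset5_teich)
  next
    assume "[m = 15] (mod 20)"
    with m4 have "m mod 4 = 3" by fastforce
    note dynamics = dynamics_3_mod_4[OF this]
    \<comment> \<open>Each of the two roots lies in only one of the two classes, so the removal can
      be done class by class.\<close>
    have "(coset5 2 \<union> coset5 3) - {z5_i, - z5_i} = (coset5 2 - {z5_i}) \<union> (coset5 3 - {- z5_i})"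
      by (auto simp: mem_coset5_iff_residue residue_1_simps)
    then show ?e3
      using dynamics(1,2,5) no_minimal_component by (simp add: dynamics(3,4,6) coset5_teich)
  qed
qed

end
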